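(* For every real $r > \frac{1}{2}$ there exists $n_0$ such that for every $n \ge n_0$, $\chi(S_r^{n-1}) > n+1$.
   Context: $S_r^{n-1} = \{x \in \mathbb{R}^n : \|x\|_2 = r\}$ denotes the Euclidean sphere of radius $r$ in $\mathbb{R}^n$. Its chromatic number $\chi(S_r^{n-1})$ is the minimum number $k$ of colours such that $S_r^{n-1}$ can be partitioned into $k$ sets none of which contains two points at Euclidean distance exactly $1$. *)

theory Defs
  imports "HOL-Analysis.Analysis" "HOL-Library.Extended_Nat"
begin

text \<open>
  The dimension is quantified inside the theorem, so \<open>\<real>\<^sup>n\<close> is represented by the carrier of the
  library's \<^const>\<open>Euclidean_space\<close>, whose elements are the functions \<open>nat \<Rightarrow> real\<close> vanishing outside \<open>{..<n}\<close>.
\<close>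

definition l2_dist :: "nat \<Rightarrow> (nat \<Rightarrow> real) \<Rightarrow> (nat \<Rightarrow> real) \<Rightarrow> real" where
  "l2_dist n x y = L2_set (\<lambda>i. x i - y i) {..<n}"

text \<open>The argument \<open>n\<close> is the ambient dimension, so the sphere itself has dimension \<open>n - 1\<close>.\<close>

definition euclidean_sphere :: "nat \<Rightarrow> real \<Rightarrow> (nat \<Rightarrow> real) set" where
  "euclidean_sphere n r = {x \<in> topspace (Euclidean_space n). L2_set x {..<n} = r}"

text \<open>
  Values are extended naturals, so that the infimum is the minimum whenever a finite partition
  exists and \<open>\<infinity>\<close> otherwise. The classes of \<^const>\<open>partition_on\<close> are nonempty, which does not affect
  the minimum.
\<close>

definition chromatic_number :: "nat \<Rightarrow> (nat \<Rightarrow> real) set \<Rightarrow> enat" where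
  "chromatic_number n S = Inf {enat k | k. \<exists>P. partition_on S P \<and> finite P \<and> card P = k \<and>
     (\<forall>A\<in>P. \<forall>x\<in>A. \<forall>y\<in>A. l2_dist n x y \<noteq> 1)}"

end

theory Submission
  imports Defs "HOL-Library.Z2" "HOL-Library.Function_Algebras"
begin

text \<open>
  The proof is a Frankl--Wilson argument modulo 2. For \<open>q = 2 ^ a \<le> k < 2 * q\<close>, send a \<open>k\<close>-subset of
  \<open>{..<2 * k}\<close> to the vector with entries \<open>\<plusminus> s\<close>, where \<open>8 * q * s\<^sup>2 = 1\<close>. These vectors lie on a sphere
  of squared radius \<open>k / (4 * q)\<close>, and two of them have distance 1 iff the sets meet in \<open>k - q\<close> elements.
  A family of \<open>k\<close>-sets without this intersection size has at most \<open>\<Sum>i<q. (2 * k) choose i\<close> members: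
  the other pairs of distinct sets satisfy \<open>\<not> q dvd k - card (X \<inter> Y)\<close>, and over the field with
  two elements this condition is a polynomial of degree \<open>q - 1\<close> in the indicator vector of \<open>Y\<close>.
  As \<open>4 * r\<^sup>2 > 1\<close>, the ratio \<open>k / q\<close> can be kept at a constant greater than 1 and at most \<open>4 * r\<^sup>2\<close>;
  one further coordinate lifts the points to the sphere of radius \<open>r\<close>. Then \<open>(2 * k) choose k\<close>
  exceeds the bound on a colour class by a factor exponential in \<open>q\<close>, while \<open>n\<close> is linear in \<open>q\<close>.
\<close>

section \<open>Parity of binomial coefficients\<close>

text \<open>By absorption \<open>2 ^ a\<close> divides \<open>i * ((2 ^ a) choose i)\<close>; an odd
  second factor would force \<open>2 ^ a\<close> to divide the smaller positive number
  \<open>i\<close>.\<close>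

lemma even_two_power_choose:
  assumes "0 < i" "i < 2 ^ a"
  shows "even ((2 ^ a) choose i :: nat)"
proof (rule ccontr)
  assume odd: "odd ((2 ^ a) choose i :: nat)"
  obtain j where j: "i = Suc j" using assms(1) gr0_implies_Suc by blast
  obtain p where p: "(2::nat) ^ a = Suc p" by (metis gr0_implies_Suc zero_less_numeral zero_less_power)
  have "i * ((2 ^ a) choose i) = 2 ^ a * (p choose j)"
    using Suc_times_binomial_eq[of p j] unfolding p j by (simp add: mult.commute)
  then have "2 ^ a dvd i * ((2 ^ a) choose i)" by simp
  moreover have "coprime (2 ^ a) ((2 ^ a) choose i :: nat)"
    using odd by simp
  ultimately have "2 ^ a dvd i" by (simp add: coprime_dvd_mult_left_iff)
  then show False using assms by (auto dest: dvd_imp_le)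
qed

text \<open>In Vandermonde's identity for \<open>2 ^ a + v\<close> every term except
  \<open>i = 0\<close> is even, so the parity has period \<open>2 ^ a\<close> in \<open>u\<close>.
  In the first period only \<open>u = 2 ^ a - 1\<close> gives a nonzero coefficient.\<close>

lemma odd_choose_two_power_minus_1:
  "odd (u choose (2 ^ a - 1)) \<longleftrightarrow> 2 ^ a dvd Suc u"
proof (induction u rule: less_induct)
  case (less u)
  show ?case
  proof (cases "u < 2 ^ a")
    case True
    show ?thesis
    proof (cases "u = 2 ^ a - 1")
      case True
      then show ?thesis by simp
    next
      case False
      with \<open>u < 2 ^ a\<close> have "Suc u < 2 ^ a" by linarith
      then have "\<not> 2 ^ a dvd Suc u" by (auto dest: dvd_imp_le)
      moreover have "u choose (2 ^ a - 1) = 0" using \<open>Suc u < 2 ^ a\<close> by (intro binomial_eq_0) linarith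
      ultimately show ?thesis by (metis even_zero)
    qed
  next
    case False
    then obtain v where v: "u = 2 ^ a + v" by (metis le_iff_add not_less)
    let ?q = "(2::nat) ^ a"
    have "u choose (?q - 1) = (\<Sum>i\<le>?q - 1. (?q choose i) * (v choose (?q - 1 - i)))"
      unfolding v by (rule vandermonde[symmetric])
    also have "\<dots> = (v choose (?q - 1)) + (\<Sum>i\<in>{..?q - 1} - {0}. (?q choose i) * (v choose (?q - 1 - i)))"
      by (subst sum.remove[of _ 0]) auto
    finally have e: "u choose (?q - 1) = \<dots>" .
    have "even (\<Sum>i\<in>{..?q - 1} - {0}. (?q choose i) * (v choose (?q - 1 - i)))"
    proof (rule dvd_sum)
      fix i assume "i \<in> {..?q - 1} - {0}"
      moreover have "0 < ?q" by simp
      ultimately have "0 < i" "i < ?q" by (auto simp: le_diff_conv)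
      then show "even ((?q choose i) * (v choose (?q - 1 - i)))"
        using even_two_power_choose by simp
    qed
    then have "odd (u choose (?q - 1)) \<longleftrightarrow> odd (v choose (?q - 1))" unfolding e by simp
    also have "\<dots> \<longleftrightarrow> ?q dvd Suc v" using less.IH[of v] v by simp
    also have "\<dots> \<longleftrightarrow> ?q dvd Suc u" unfolding v by (metis add_Suc_right dvd_add_triv_left_iff)
    finally show ?thesis .
  qed
qed

section \<open>Dimension bound and multilinear monomials\<close>

interpretation fun_space: vector_space "\<lambda>(c::'b::field) (f::'a \<Rightarrow> 'b) x. c * f x"
  by unfold_locales (auto simp: fun_eq_iff algebra_simps)

text \<open>Evaluating a vanishing combination at \<open>x\<close> isolates the coefficient of
  \<open>f x\<close>, so the functions are distinct and linearly independent.\<close>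

lemma card_le_of_biorthogonal_in_span:
  fixes f :: "'a \<Rightarrow> 'a \<Rightarrow> 'b::field"
  assumes F: "finite F" and B: "finite B" and span: "f ` F \<subseteq> fun_space.span B"
    and f_eq: "\<And>x y. x \<in> F \<Longrightarrow> y \<in> F \<Longrightarrow> f x y = of_bool (x = y)"
  shows "card F \<le> card B"
proof -
  have inj: "inj_on f F"
    by (rule inj_onI) (metis f_eq of_bool_eq_iff)
  have "fun_space.independent (f ` F)"
  proof (rule fun_space.independent_if_scalars_zero)
    show "finite (f ` F)" using F by simp
    fix c g assume z: "(\<Sum>g\<in>f ` F. (\<lambda>y. c g * g y)) = 0" and "g \<in> f ` F"
    then obtain x where x: "x \<in> F" "g = f x" by blast
    have app: "(\<Sum>g\<in>G. h g) y = (\<Sum>g\<in>G. h g y)" if "finite G"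
      for G :: "('a \<Rightarrow> 'b) set" and h :: "_ \<Rightarrow> 'a \<Rightarrow> 'b" and y
      using that by (induction G rule: finite_induct) auto
    have "0 = (\<Sum>g\<in>f ` F. (\<lambda>y. c g * g y)) x" unfolding z by simp
    also have "\<dots> = (\<Sum>g\<in>f ` F. c g * g x)" using F by (subst app) auto
    also have "\<dots> = (\<Sum>z\<in>F. c (f z) * f z x)" using inj by (subst sum.reindex) auto
    also have "\<dots> = (\<Sum>z\<in>F. if z = x then c (f z) else 0)"
      using x f_eq by (intro sum.cong) auto
    also have "\<dots> = c g" using x F by simp
    finally show "c g = 0" by simp
  qed
  then have "card (f ` F) \<le> card B"
    using fun_space.independent_span_bound[OF B] span by blast
  then show ?thesis using inj by (simp add: card_image)
qed

text \<open>This is the product of the variables indexed by \<open>S\<close>, evaluated at the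
  indicator vector of \<open>Y\<close>.\<close>

definition subset_monomial :: "'a set \<Rightarrow> 'a set \<Rightarrow> 'b::field" where
  "subset_monomial S = (\<lambda>Y. of_bool (S \<subseteq> Y))"

text \<open>A binomial coefficient with lower index \<open>D\<close> is a polynomial of degree at
  most \<open>D\<close> in the indicator vector of \<open>Y\<close>. Adding \<open>e\<close> to
  \<open>X\<close> lowers the upper index exactly when \<open>e \<in> Y\<close>, and Pascal's rule
  then subtracts a term carrying the variable of \<open>e\<close>. The factor for \<open>T\<close>
  collects these variables in the induction; \<open>card X \<le> a\<close> keeps the subtraction
  exact.\<close>

lemma monomial_choose_in_span:
  assumes "finite U" "X \<subseteq> U" "T \<subseteq> U" "card X \<le> a"
  shows "(\<lambda>Y. subset_monomial T Y * of_nat ((a - card (X \<inter> Y)) choose D) :: 'b::field)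
     \<in> fun_space.span (subset_monomial ` {S. S \<subseteq> U \<and> card S \<le> D + card T})"
proof -
  have "finite X" using assms finite_subset by blast
  then show ?thesis using assms(2-)
  proof (induction X arbitrary: T a D rule: finite_induct)
    case empty
    have "(\<lambda>Y. of_nat (a choose D) * subset_monomial T Y :: 'b)
      \<in> fun_space.span (subset_monomial ` {S. S \<subseteq> U \<and> card S \<le> D + card T})"
      using empty by (intro fun_space.span_scale fun_space.span_base) auto
    then show ?case by (simp add: mult.commute)
  next
    case (insert e X)
    have 1: "(\<lambda>Y. subset_monomial T Y * of_nat ((a - card (X \<inter> Y)) choose D) :: 'b)
      \<in> fun_space.span (subset_monomial ` {S. S \<subseteq> U \<and> card S \<le> D + card T})"
      by (rule insert.IH) (use insert in auto)
    show ?case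
    proof (cases D)
      case 0
      then show ?thesis using 1 by simp
    next
      case (Suc d)
      obtain b where b: "a = Suc b" using insert by (cases a) auto
      have fin: "finite T" using insert.prems assms(1) finite_subset by blast
      have 2: "(\<lambda>Y. subset_monomial (insert e T) Y * of_nat ((b - card (X \<inter> Y)) choose d) :: 'b)
        \<in> fun_space.span (subset_monomial ` {S. S \<subseteq> U \<and> card S \<le> d + card (insert e T)})"
        by (rule insert.IH) (use insert b in auto)
      \<comment> \<open>The variable gained in \<open>insert e T\<close> is paid for by the drop
        from \<open>D\<close> to \<open>d\<close>.\<close>
      have sub: "(subset_monomial :: _ \<Rightarrow> _ \<Rightarrow> 'b) ` {S. S \<subseteq> U \<and> card S \<le> d + card (insert e T)}
        \<subseteq> subset_monomial ` {S. S \<subseteq> U \<and> card S \<le> D + card T}"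
        using card_insert_le_m1 Suc fin by (auto simp: card_insert_if split: if_splits)
      have eq: "(\<lambda>Y. subset_monomial T Y * of_nat ((a - card (insert e X \<inter> Y)) choose D) :: 'b)
        = (\<lambda>Y. subset_monomial T Y * of_nat ((a - card (X \<inter> Y)) choose D))
        - (\<lambda>Y. subset_monomial (insert e T) Y * of_nat ((b - card (X \<inter> Y)) choose d))"
      proof
        fix Y
        have le: "card (X \<inter> Y) \<le> b"
          using insert b card_mono[of X "X \<inter> Y"] by auto
        have "of_nat ((a - card (X \<inter> Y)) choose D)
            = (of_nat ((b - card (X \<inter> Y)) choose D) + of_nat ((b - card (X \<inter> Y)) choose d) :: 'b)"
          using le by (simp add: b Suc Suc_diff_le add.commute)
        moreover have "card (insert e X \<inter> Y) = (if e \<in> Y then Suc (card (X \<inter> Y)) else card (X \<inter> Y))"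
          using insert by simp
        ultimately show "subset_monomial T Y * (of_nat ((a - card (insert e X \<inter> Y)) choose D) :: 'b)
          = ((\<lambda>Y. subset_monomial T Y * of_nat ((a - card (X \<inter> Y)) choose D))
        - (\<lambda>Y. subset_monomial (insert e T) Y * of_nat ((b - card (X \<inter> Y)) choose d))) Y"
          by (auto simp: subset_monomial_def b algebra_simps)
      qed
      show ?thesis unfolding eq
        by (rule fun_space.span_diff[OF 1]) (use 2 fun_space.span_mono[OF sub] in blast)
    qed
  qed
qed

section \<open>Families avoiding one intersection size\<close>

lemma of_nat_bit_eq: "(of_nat n :: bit) = of_bool (odd n)"
  by (induction n) auto

text \<open>Since \<open>k < 2 * q\<close>, the only multiples of \<open>q\<close> that
  \<open>k - card (X \<inter> Y)\<close> can equal are 0 and \<open>q\<close>. The value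
  \<open>q\<close> is excluded, and 0 means \<open>X = Y\<close>; hence the parity criterion makes
  the functions \<open>f X\<close> biorthogonal.\<close>

lemma forbidden_intersection_bound:
  assumes U: "finite U" and F: "\<And>X. X \<in> F \<Longrightarrow> X \<subseteq> U \<and> card X = k"
    and q: "q = 2 ^ a" "q \<le> k" "k < 2 * q"
    and avoid: "\<And>X Y. X \<in> F \<Longrightarrow> Y \<in> F \<Longrightarrow> card (X \<inter> Y) \<noteq> k - q"
  shows "card F \<le> card {S. S \<subseteq> U \<and> card S < q}"
proof -
  let ?B = "{S. S \<subseteq> U \<and> card S < q}"
  \<comment> \<open>The shift by \<open>q\<close>, harmless modulo \<open>q\<close>, keeps the natural subtraction from truncating when \<open>X = Y\<close>.\<close>
  define f where "f X = (\<lambda>Y. of_nat ((k + q - 1 - card (X \<inter> Y)) choose (q - 1)) :: bit)" for X :: "'a set"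
  have q0: "0 < q" using q by simp
  have finF: "finite F" by (rule finite_subset[of _ "Pow U"]) (use U F in auto)
  have f_eq: "f X Y = of_bool (X = Y)" if "X \<in> F" "Y \<in> F" for X Y
  proof -
    have fin: "finite X" "finite Y" using F that U finite_subset by blast+
    have le: "card (X \<inter> Y) \<le> k" using F[OF that(1)] fin card_mono[of X "X \<inter> Y"] by auto
    have "odd ((k + q - 1 - card (X \<inter> Y)) choose (q - 1)) \<longleftrightarrow> q dvd Suc (k + q - 1 - card (X \<inter> Y))"
      unfolding q(1) by (rule odd_choose_two_power_minus_1)
    also have "Suc (k + q - 1 - card (X \<inter> Y)) = (k - card (X \<inter> Y)) + q" using le q0 by simp
    also have "q dvd (k - card (X \<inter> Y)) + q \<longleftrightarrow> q dvd (k - card (X \<inter> Y))" by simp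
    also have "\<dots> \<longleftrightarrow> k - card (X \<inter> Y) = 0"
    proof
      assume "q dvd (k - card (X \<inter> Y))"
      then obtain c where c: "k - card (X \<inter> Y) = q * c" by blast
      then have "q * c < q * 2" using q by linarith
      then have "c < 2" by simp
      moreover have "c \<noteq> 1"
      proof
        assume "c = 1"
        then have "card (X \<inter> Y) = k - q" using c le q(2) by simp
        then show False using avoid that by blast
      qed
      ultimately show "k - card (X \<inter> Y) = 0" using c by simp
    qed simp
    also have "\<dots> \<longleftrightarrow> X = Y"
    proof
      assume "k - card (X \<inter> Y) = 0"
      then have "card (X \<inter> Y) = k" using le by simp
      then have "X \<inter> Y = X" "X \<inter> Y = Y" using F that fin card_subset_eq by (metis Int_lower1, metis Int_lower2)
      then show "X = Y" by simp
    next
      assume "X = Y"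
      then show "k - card (X \<inter> Y) = 0" using F that by simp
    qed
    finally show ?thesis by (simp only: f_def of_nat_bit_eq)
  qed
  have "f ` F \<subseteq> fun_space.span (subset_monomial ` ?B)"
  proof
    fix x assume "x \<in> f ` F"
    then obtain X where X: "X \<in> F" "x = f X" by blast
    \<comment> \<open>The empty monomial is the constant 1, so the degree is at most
      \<open>q - 1\<close>.\<close>
    have "(\<lambda>Y. subset_monomial {} Y * of_nat ((k + q - 1 - card (X \<inter> Y)) choose (q - 1)))
      \<in> fun_space.span (subset_monomial ` {S. S \<subseteq> U \<and> card S \<le> (q - 1) + card ({}::'a set)})"
      using F[OF X(1)] U q0 by (intro monomial_choose_in_span) auto
    moreover have "{S. S \<subseteq> U \<and> card S \<le> (q - 1) + card ({}::'a set)} = ?B" using q0 by auto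
    moreover have "x = (\<lambda>Y. subset_monomial {} Y * of_nat ((k + q - 1 - card (X \<inter> Y)) choose (q - 1)))"
      by (simp add: X f_def subset_monomial_def del: mult_bit_eq_and)
    ultimately show "x \<in> fun_space.span (subset_monomial ` ?B)"
      by (simp only:)
  qed
  moreover have finB: "finite ?B" using U by simp
  ultimately have "card F \<le> card ((subset_monomial :: _ \<Rightarrow> _ \<Rightarrow> bit) ` ?B)"
    using card_le_of_biorthogonal_in_span[OF finF finite_imageI _ f_eq] by blast
  also have "\<dots> \<le> card ?B" using finB by (rule card_image_le)
  finally show ?thesis .
qed

section \<open>Small subsets against the central binomial coefficient\<close>

text \<open>For \<open>i < (L + 1) * h\<close> the ratio of consecutive coefficients,
  \<open>(2 * k - i) / (i + 1)\<close>, is at least \<open>(L + 3) / (L + 1)\<close>. From any level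
  below \<open>q = L * h\<close> there are \<open>h\<close> such steps upward, and there are
  \<open>q\<close> levels to sum.\<close>

lemma card_small_subsets_le:
  fixes L h :: nat
  defines "q \<equiv> L * h" and "k \<equiv> (L + 2) * h"
  shows "(L + 3) ^ h * card {S. S \<subseteq> {..<2 * k} \<and> card S < q} \<le> q * (L + 1) ^ h * ((2 * k) choose k)"
proof (cases "h = 0")
  case True
  then show ?thesis by (simp add: q_def)
next
  case False
  have step: "(L + 3) * ((2 * k) choose i) \<le> (L + 1) * ((2 * k) choose Suc i)" if "i < (L + 1) * h" for i
  proof -
    have "(L + 3) * h \<le> 2 * k - i" using that by (simp add: k_def algebra_simps)
    then have "(L + 3) * h * ((2 * k) choose i) \<le> (2 * k - i) * ((2 * k) choose i)" by simp
    also have "\<dots> = Suc i * ((2 * k) choose Suc i)"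
      by (metis binomial_absorb_comp binomial_absorption)
    also have "\<dots> \<le> (L + 1) * h * ((2 * k) choose Suc i)" using that by (intro mult_right_mono) auto
    finally have "h * ((L + 3) * ((2 * k) choose i)) \<le> h * ((L + 1) * ((2 * k) choose Suc i))"
      by (simp only: mult_ac)
    then show ?thesis using False by simp
  qed
  have iter: "(L + 3) ^ j * ((2 * k) choose i) \<le> (L + 1) ^ j * ((2 * k) choose (i + j))" if "i + j \<le> (L + 1) * h" for i j
    using that
  proof (induction j)
    case (Suc j)
    have "(L + 3) ^ Suc j * ((2 * k) choose i) \<le> (L + 3) * ((L + 1) ^ j * ((2 * k) choose (i + j)))"
      using Suc by (simp add: mult.assoc)
    also have "\<dots> = (L + 1) ^ j * ((L + 3) * ((2 * k) choose (i + j)))" by (simp only: mult_ac)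
    also have "\<dots> \<le> (L + 1) ^ j * ((L + 1) * ((2 * k) choose Suc (i + j)))"
      using Suc.prems by (intro mult_left_mono step) auto
    finally show ?case by (simp only: power_Suc add_Suc_right mult_ac)
  qed simp
  have "{S. S \<subseteq> {..<2 * k} \<and> card S < q} = (\<Union>i<q. {S. S \<subseteq> {..<2 * k} \<and> card S = i})" by auto
  also have "card \<dots> \<le> (\<Sum>i<q. card {S. S \<subseteq> {..<2 * k} \<and> card S = i})" by (rule card_UN_le) simp
  also have "\<dots> = (\<Sum>i<q. (2 * k) choose i)" by (simp add: n_subsets)
  finally have "(L + 3) ^ h * card {S. S \<subseteq> {..<2 * k} \<and> card S < q} \<le> (\<Sum>i<q. (L + 3) ^ h * ((2 * k) choose i))"
    by (simp flip: sum_distrib_left)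
  also have "\<dots> \<le> (\<Sum>i<q. (L + 1) ^ h * ((2 * k) choose k))"
  proof (rule sum_mono)
    fix i assume "i \<in> {..<q}"
    then have "(L + 3) ^ h * ((2 * k) choose i) \<le> (L + 1) ^ h * ((2 * k) choose (i + h))"
      by (intro iter) (simp add: q_def)
    also have "(2 * k) choose (i + h) \<le> (2 * k) choose k"
      using binomial_maximum'[of k "i + h"] by simp
    finally show "(L + 3) ^ h * ((2 * k) choose i) \<le> (L + 1) ^ h * ((2 * k) choose k)" by simp
  qed
  finally show ?thesis by simp
qed

section \<open>Embedding \<open>k\<close>-subsets into the sphere\<close>

text \<open>Each colour class pulls back along \<open>v\<close> to a family of \<open>k\<close>-sets
  with no intersection of size \<open>k - q\<close>, so the intersection bound applies to each class
  and the classes together cover all \<open>k\<close>-sets.\<close>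

lemma central_binomial_le_colours:
  fixes r :: real
  assumes q: "q = 2 ^ a" "q \<le> k" "k < 2 * q" and n: "2 * k < n" and r: "0 < r" "k \<le> 4 * r\<^sup>2 * q"
    and P: "partition_on (euclidean_sphere n r) P" "finite P"
    and no_unit: "\<And>A x y. A \<in> P \<Longrightarrow> x \<in> A \<Longrightarrow> y \<in> A \<Longrightarrow> l2_dist n x y \<noteq> 1"
  shows "(2 * k) choose k \<le> card P * card {S. S \<subseteq> {..<2 * k} \<and> card S < q}"
proof -
  define s where "s = sqrt (1 / (8 * q))"
  \<comment> \<open>The entries \<open>\<plusminus> s\<close> contribute
    \<open>2 * k * s\<^sup>2 = k / (4 * q)\<close> to the squared norm; \<open>t\<close> supplies
    the rest, which is nonnegative by the radius condition.\<close>
  define t where "t = sqrt (r\<^sup>2 - k / (4 * q))"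
  define v where "v X = (\<lambda>i. if i < 2 * k then (if i \<in> X then s else - s) else if i = 2 * k then t else 0)"
    for X :: "nat set"
  let ?K = "{X. X \<subseteq> {..<2 * k} \<and> card X = k}"
  have q0: "0 < q" using q by simp
  have s2: "s\<^sup>2 = 1 / (8 * q)" by (simp add: s_def)
  have t2: "t\<^sup>2 = r\<^sup>2 - k / (4 * q)" using r q0 by (simp add: t_def field_simps)
  have split: "{..<n} = {..<2 * k} \<union> {2 * k} \<union> {2 * k<..<n}" using n by auto
  have sum_split: "(\<Sum>i<n. g i) = (\<Sum>i<2 * k. g i) + g (2 * k) + (\<Sum>i\<in>{2 * k<..<n}. g i)" for g :: "nat \<Rightarrow> real"
    unfolding split by (subst sum.union_disjoint, auto)+
  have sphere: "v X \<in> euclidean_sphere n r" for X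
  proof -
    have "(\<Sum>i<2 * k. (v X i)\<^sup>2) = (\<Sum>i<2 * k. s\<^sup>2)" by (rule sum.cong) (auto simp: v_def)
    moreover have "(\<Sum>i\<in>{2 * k<..<n}. (v X i)\<^sup>2) = 0" by (rule sum.neutral) (auto simp: v_def)
    moreover have "(v X (2 * k))\<^sup>2 = t\<^sup>2" by (simp add: v_def)
    ultimately have "(\<Sum>i<n. (v X i)\<^sup>2) = (\<Sum>i<2 * k. s\<^sup>2) + t\<^sup>2" unfolding sum_split by simp
    also have "\<dots> = r\<^sup>2" using q0 by (simp add: s2 t2 field_simps)
    finally have "L2_set (v X) {..<n} = r" using r by (simp add: L2_set_def)
    then show ?thesis using n by (simp add: euclidean_sphere_def topspace_Euclidean_space v_def)
  qed
  have dist: "l2_dist n (v X) (v Y) = 1" if X: "X \<in> ?K" and Y: "Y \<in> ?K" and XY: "card (X \<inter> Y) = k - q" for X Y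
  proof -
    have fin: "finite X" "finite Y" using X Y finite_subset by blast+
    have "card (sym_diff X Y) = card (X - Y) + card (Y - X)"
      using fin by (intro card_Un_disjoint) auto
    also have "\<dots> = q + q"
      using X Y XY fin q(2) card_Diff_subset_Int[of X Y] card_Diff_subset_Int[of Y X] by (simp add: Int_commute)
    finally have c: "card (sym_diff X Y) = 2 * q" by simp
    \<comment> \<open>The lifting coordinate \<open>t\<close> cancels; a coordinate in exactly one
      of the sets contributes \<open>(2 * s)\<^sup>2\<close>.\<close>
    have "(\<Sum>i<n. (v X i - v Y i)\<^sup>2) = (\<Sum>i<2 * k. if i \<in> sym_diff X Y then 4 * s\<^sup>2 else 0)"
      unfolding sum_split by (auto simp: v_def power2_eq_square intro!: sum.cong)
    also have "\<dots> = (\<Sum>i\<in>sym_diff X Y. 4 * s\<^sup>2)"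
      using X Y by (subst sum.inter_restrict[symmetric], simp, intro sum.cong) auto
    also have "\<dots> = 1" using q0 by (simp only: sum_constant c s2) (simp add: field_simps)
    finally show ?thesis by (simp add: l2_dist_def L2_set_def)
  qed
  have "?K \<subseteq> (\<Union>A\<in>P. {X \<in> ?K. v X \<in> A})"
    using sphere P(1) by (auto simp: partition_on_def)
  then have "card ?K \<le> card (\<Union>A\<in>P. {X \<in> ?K. v X \<in> A})"
    using P(2) by (intro card_mono) auto
  also have "\<dots> \<le> (\<Sum>A\<in>P. card {X \<in> ?K. v X \<in> A})" using P(2) by (rule card_UN_le)
  also have "\<dots> \<le> (\<Sum>A\<in>P. card {S. S \<subseteq> {..<2 * k} \<and> card S < q})"
  proof (rule sum_mono)
    fix A assume A: "A \<in> P"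
    show "card {X \<in> ?K. v X \<in> A} \<le> card {S. S \<subseteq> {..<2 * k} \<and> card S < q}"
    proof (rule forbidden_intersection_bound[OF _ _ q])
      fix X Y assume "X \<in> {X \<in> ?K. v X \<in> A}" "Y \<in> {X \<in> ?K. v X \<in> A}"
      then show "card (X \<inter> Y) \<noteq> k - q" using no_unit[OF A] dist by blast
    qed auto
  qed
  finally show ?thesis by (simp add: n_subsets)
qed

section \<open>Growth estimate and choice of parameters\<close>

text \<open>With \<open>y\<^sup>2 = (L + 1) / (L + 3)\<close> the inequality reads
  \<open>8 * L\<^sup>2 * (h * y ^ h)\<^sup>2 < 1\<close>; the square root reduces it to the limit of
  \<open>h * y ^ h\<close>.\<close>

lemma eventually_square_times_power_less:
  fixes L :: nat
  shows "\<forall>\<^sub>F h in sequentially. 8 * (L * h)\<^sup>2 * (L + 1) ^ h < (L + 3) ^ h"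
proof -
  define y where "y = sqrt ((L + 1) / (L + 3))"
  have y: "0 \<le> y" "y < 1" "y\<^sup>2 = (real L + 1) / (L + 3)" by (auto simp: y_def)
  have "(\<lambda>h. real h * y ^ h) \<longlonglongrightarrow> 0" using y by (intro powser_times_n_limit_0) auto
  then have "(\<lambda>h. 8 * (real L)\<^sup>2 * (real h * y ^ h)\<^sup>2) \<longlonglongrightarrow> 8 * (real L)\<^sup>2 * 0\<^sup>2"
    by (intro tendsto_intros)
  then have "\<forall>\<^sub>F h in sequentially. 8 * (real L)\<^sup>2 * (real h * y ^ h)\<^sup>2 < 1"
    by (rule order_tendstoD) simp
  then show ?thesis
  proof eventually_elim
    case (elim h)
    have "(y ^ h)\<^sup>2 = (real L + 1) ^ h / (real L + 3) ^ h"
      by (simp add: power2_eq_square power_divide y(3)[unfolded power2_eq_square] flip: power_mult_distrib)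
    then have "8 * (real L * real h)\<^sup>2 * (real L + 1) ^ h < (real L + 3) ^ h"
      using elim by (simp add: power_mult_distrib pos_divide_less_eq mult.assoc)
    then have "real (8 * (L * h)\<^sup>2 * (L + 1) ^ h) < real ((L + 3) ^ h)" by (simp add: add_ac)
    then show ?case by (simp only: of_nat_less_iff)
  qed
qed

theorem theorem3:
  fixes r :: real
  assumes "r > 1 / 2"
  shows "\<exists>n0::nat. \<forall>n\<ge>n0. chromatic_number n (euclidean_sphere n r) > enat (n + 1)"
proof -
  have r4: "4 * r\<^sup>2 > 1" using power_strict_mono[OF assms, of 2] by (simp add: power2_eq_square)
  obtain b0 where b0: "2 / (4 * r\<^sup>2 - 1) < 2 ^ b0"
    using real_arch_pow[of 2] by auto
  \<comment> \<open>With \<open>q = L * h\<close> and \<open>k = (L + 2) * h\<close> the radius condition becomes \<open>(L + 2) / L \<le> 4 * r\<^sup>2\<close>.\<close>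
  define b where "b = b0 + 2"
  define L :: nat where "L = 2 ^ b"
  have "(2::real) ^ b0 \<le> 2 ^ b" unfolding b_def by (rule power_increasing) auto
  with b0 have "2 / (4 * r\<^sup>2 - 1) \<le> 2 ^ b" by linarith
  then have "2 / (4 * r\<^sup>2 - 1) \<le> real L" by (simp add: L_def)
  then have Lr: "real L + 2 \<le> 4 * r\<^sup>2 * L" using r4 by (simp add: field_simps)
  \<comment> \<open>The summand 2 in \<open>b\<close> secures this bound, which gives
    \<open>L + 2 < 2 * L\<close> and hence \<open>k < 2 * q\<close>.\<close>
  have L4: "4 \<le> L" by (simp add: L_def b_def)
  obtain h0 where h0: "\<And>h. h \<ge> h0 \<Longrightarrow> 8 * (L * h)\<^sup>2 * (L + 1) ^ h < (L + 3) ^ h"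
    using eventually_square_times_power_less[of L] unfolding eventually_sequentially by blast
  show ?thesis
  proof (intro exI allI impI)
    fix n assume n: "4 * L * (2 * h0 + 2) \<le> n"
    define m where "m = n div (4 * L)"
    have m: "2 * h0 + 2 \<le> m" using n L4 by (simp add: m_def less_eq_div_iff_mult_less_eq mult.commute)
    \<comment> \<open>Taking the largest power of two up to \<open>m\<close> makes \<open>q\<close>
      a power of two with \<open>4 * q \<le> n < 8 * q\<close>. As \<open>h > m / 2\<close>, the
      threshold on \<open>n\<close> ensures \<open>h \<ge> h0\<close>.\<close>
    obtain e where e: "2 ^ e \<le> m" "m < 2 ^ (e + 1)"
      using ex_power_ivl1[of 2 m] m by auto
    define h :: nat where "h = 2 ^ e"
    define q where "q = L * h"
    define k where "k = (L + 2) * h"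
    have h: "h0 \<le> h" "h > 0" using e m by (auto simp: h_def)
    have n4: "4 * q \<le> n"
    proof -
      have "4 * L * h \<le> 4 * L * m" using e by (simp add: h_def)
      also have "\<dots> \<le> n" by (simp add: m_def)
      finally show ?thesis by (simp add: q_def)
    qed
    have n8: "n + 1 \<le> 8 * q"
    proof -
      have "n < 4 * L * (m + 1)" using L4 by (simp add: m_def dividend_less_times_div)
      also have "\<dots> \<le> 4 * L * (2 * h)" using e by (intro mult_left_mono) (auto simp: h_def)
      finally show ?thesis by (simp add: q_def)
    qed
    have q: "q = 2 ^ (b + e)" "q \<le> k" "k < 2 * q"
    proof -
      show "q = 2 ^ (b + e)" by (simp add: q_def L_def h_def power_add)
      show "q \<le> k" by (simp add: q_def k_def)
      have "(L + 2) * h < 2 * L * h" using L4 h by (intro mult_strict_right_mono) auto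
      then show "k < 2 * q" by (simp add: q_def k_def)
    qed
    have kr: "k \<le> 4 * r\<^sup>2 * q"
      using mult_right_mono[OF Lr, of h] by (simp add: k_def q_def algebra_simps)
    let ?B = "card {S. S \<subseteq> {..<2 * k} \<and> card S < q}"
    have "(L + 3) ^ h * ((n + 1) * ?B) \<le> 8 * q * ((L + 3) ^ h * ?B)"
      using mult_right_mono[OF n8, of "(L + 3) ^ h * ?B"] by (simp only: mult_ac)
    also have "\<dots> \<le> 8 * q * (q * (L + 1) ^ h * ((2 * k) choose k))"
      unfolding q_def k_def by (intro mult_left_mono card_small_subsets_le) simp
    also have "\<dots> = (8 * (L * h)\<^sup>2 * (L + 1) ^ h) * ((2 * k) choose k)"
      by (simp add: q_def power2_eq_square)
    also have "\<dots> < (L + 3) ^ h * ((2 * k) choose k)"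
      using h0[OF h(1)] by (intro mult_strict_right_mono) auto
    finally have B: "(n + 1) * ?B < (2 * k) choose k" by simp
    \<comment> \<open>As a non-strict bound by the next integer, the claim passes to the infimum,
      also if no finite partition exists.\<close>
    have "enat (n + 2) \<le> chromatic_number n (euclidean_sphere n r)"
      unfolding chromatic_number_def
    proof (rule Inf_greatest, clarify)
      fix P assume P: "partition_on (euclidean_sphere n r) P" "finite P"
        "\<forall>A\<in>P. \<forall>x\<in>A. \<forall>y\<in>A. l2_dist n x y \<noteq> 1"
      \<comment> \<open>The lifting coordinate fits because
        \<open>2 * k < 4 * q \<le> n\<close>.\<close>
      have "(2 * k) choose k \<le> card P * ?B"
        using q n4 kr P assms by (intro central_binomial_le_colours[where r = r and n = n]) auto
      with B have "(n + 1) * ?B < card P * ?B" by linarith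
      then have "n + 1 < card P" by (simp only: mult_less_cancel2)
      then show "enat (n + 2) \<le> enat (card P)" by simp
    qed
    moreover have "enat (n + 1) < enat (n + 2)" by simp
    ultimately show "enat (n + 1) < chromatic_number n (euclidean_sphere n r)" by (rule less_le_trans[rotated])
  qed
qed

end
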